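(* Suppose $F\in\mathcal{E}^m$ takes the form $F(\Sigma)=\mathrm{tr}(\phi(\Sigma))$ with $\phi$ (real) analytic on $(0,+\infty)$. Let $\mathcal{L}\subseteq\mathbb{S}^m$ be a linear subspace such that $\tfrac12(AB+BA)\in\mathcal{L}$ for all $A,B\in\mathcal{L}$, and such that $I_m\in\mathcal{L}$. Then, for $\Sigma\in\mathbb{S}^m_+$, $\Sigma\in\mathcal{L}\cap\mathbb{S}^m_+$ if and only if $\nabla F(\Sigma)\in\mathcal{L}\cap\mathbb{L}^m_+$.
   Context: $\mathbb{S}^m$ is the space of real symmetric $m\times m$ matrices with inner product $\langle A,B\rangle=\mathrm{tr}(AB)$; $\mathbb{S}^m_+$ and $\overline{\mathbb{S}}^m_+$ are the subsets of positive definite and positive semidefinite matrices. $\mathcal{E}^m$ is the set of functions $F:\mathbb{S}^m\to\mathbb{R}\cup\{+\infty\}$ such that (i) $F$ is convex, not identically $+\infty$, and lower semicontinuous; (ii) $\mathbb{S}^m_+\subseteq\mathrm{dom}(F)\subseteq\overline{\mathbb{S}}^m_+$, where $\mathrm{dom}(F)=\{F<+\infty\}$; (iii) $F$ is strictly convex and continuously differentiable on $\mathbb{S}^m_+$. Gradients are with respect to $\langle\cdot,\cdot\rangle$. $\mathbb{L}^m_+:=\nabla F(\mathbb{S}^m_+)$. For $\phi:\mathbb{R}\to\mathbb{R}\cup\{+\infty\}$, $\phi(\Sigma)$ is the matrix function obtained by applying $\phi$ to the eigenvalues, so $\mathrm{tr}(\phi(\Sigma))=\sum_{i=1}^m\phi(\lambda_i(\Sigma))$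 with $\lambda_i(\Sigma)$ the eigenvalues of $\Sigma$. *)

theory Defs
  imports "HOL-Analysis.Analysis" "HOL-Computational_Algebra.Polynomial"
begin

definition sym_mats :: "(real^'m^'m) set" where
  "sym_mats = {A. transpose A = A}"

definition pos_def_mats :: "(real^'m^'m) set" where
  "pos_def_mats = {A \<in> sym_mats. \<forall>x. x \<noteq> 0 \<longrightarrow> 0 < x \<bullet> (A *v x)}"

definition pos_semidef_mats :: "(real^'m^'m) set" where
  "pos_semidef_mats = {A \<in> sym_mats. \<forall>x. 0 \<le> x \<bullet> (A *v x)}"

(* A function F from the symmetric matrices to the extended reals is a function on all square
   matrices of which only the values on sym_mats are ever used. *)

definition eff_domain :: "(real^'m^'m \<Rightarrow> ereal) \<Rightarrow> (real^'m^'m) set" where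
  "eff_domain F = {A \<in> sym_mats. F A < \<infinity>}"

(* G is the gradient of F at A for the inner product tr (G ** H) on sym_mats. The derivative
   is taken within the subspace sym_mats, and G is required to lie in it. *)
definition has_sym_gradient ::
    "(real^'m^'m \<Rightarrow> ereal) \<Rightarrow> real^'m^'m \<Rightarrow> real^'m^'m \<Rightarrow> bool" where
  "has_sym_gradient F G A \<longleftrightarrow> G \<in> sym_mats \<and>
     ((\<lambda>X. real_of_ereal (F X)) has_derivative (\<lambda>H. trace (G ** H))) (at A within sym_mats)"

definition sym_gradient :: "(real^'m^'m \<Rightarrow> ereal) \<Rightarrow> real^'m^'m \<Rightarrow> real^'m^'m" where
  "sym_gradient F A = (THE G. has_sym_gradient F G A)"

definition convex_class :: "(real^'m^'m \<Rightarrow> ereal) set" where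
  "convex_class = {F.
     (\<forall>A\<in>sym_mats. F A \<noteq> -\<infinity>) \<and>
     (\<forall>A\<in>sym_mats. \<forall>B\<in>sym_mats. \<forall>t::real. 0 < t \<and> t < 1 \<longrightarrow>
        F ((1 - t) *\<^sub>R A + t *\<^sub>R B) \<le> ereal (1 - t) * F A + ereal t * F B) \<and>
     (\<exists>A\<in>sym_mats. F A \<noteq> \<infinity>) \<and>
     (\<forall>A\<in>sym_mats. F A \<le> Liminf (at A within sym_mats) F) \<and>
     pos_def_mats \<subseteq> eff_domain F \<and> eff_domain F \<subseteq> pos_semidef_mats \<and>
     (\<forall>A\<in>pos_def_mats. \<forall>B\<in>pos_def_mats. \<forall>t::real. A \<noteq> B \<and> 0 < t \<and> t < 1 \<longrightarrow>
        F ((1 - t) *\<^sub>R A + t *\<^sub>R B) < ereal (1 - t) * F A + ereal t * F B) \<and>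
     (\<forall>A\<in>pos_def_mats. \<exists>G. has_sym_gradient F G A) \<and>
     continuous_on pos_def_mats (sym_gradient F)}"

definition gradient_image :: "(real^'m^'m \<Rightarrow> ereal) \<Rightarrow> (real^'m^'m) set" where
  "gradient_image F = sym_gradient F ` pos_def_mats"

definition char_polynomial :: "real^'m^'m \<Rightarrow> real poly" where
  "char_polynomial A = det (\<chi> i j. (if i = j then [:0, 1:] else 0) - [:A $ i $ j:])"

(* For symmetric A all roots are real, so this multiset has CARD('m) elements. *)
definition eigenvalues_mset :: "real^'m^'m \<Rightarrow> real multiset" where
  "eigenvalues_mset A = proots (char_polynomial A)"

(* tr (phi(A)) as the sum of phi over the eigenvalues, counted with multiplicity; this form
   makes sense when phi takes the value infinity. *)
definition trace_matrix_fun :: "(real \<Rightarrow> ereal) \<Rightarrow> real^'m^'m \<Rightarrow> ereal" where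
  "trace_matrix_fun \<phi> A = (\<Sum>x\<in>#eigenvalues_mset A. \<phi> x)"

definition real_analytic_on :: "(real \<Rightarrow> real) \<Rightarrow> real set \<Rightarrow> bool" where
  "real_analytic_on f S \<longleftrightarrow> (\<forall>x\<in>S. \<exists>r>0. \<exists>a :: nat \<Rightarrow> real.
     \<forall>y. \<bar>y - x\<bar> < r \<longrightarrow> (\<lambda>n. a n * (y - x) ^ n) sums f y)"

end

theory Submission
  imports Defs
begin

text \<open>
  Diagonalize \<open>X = U ** diag_mat d ** transpose U\<close> with \<open>U\<close> orthogonal. Since \<open>F\<close> depends only on
  the eigenvalues, it is invariant under orthogonal conjugation and its gradient is equivariant, so
  the gradient at \<open>X\<close> is the conjugate of the gradient at \<open>diag_mat d\<close>. Sign flips of the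
  coordinates fix \<open>diag_mat d\<close>, hence the gradient there is diagonal
  (\<open>spectral_gradient_at_diag_mat_is_diagonal\<close>), and its entries are the partial derivatives
  \<open>e i = \<phi>' (d i)\<close> (\<open>spectral_gradient_diagonal_entry\<close>).

  Restricting \<open>F\<close> to the positive multiples of the identity shows that \<open>\<phi>\<close> is strictly convex on
  the positive reals (\<open>spectral_profile_strictly_convex\<close>), so \<open>\<phi>'\<close> is injective and
  \<open>d i = d j\<close> holds exactly when \<open>e i = e j\<close>. By interpolation at finitely many points, each of
  \<open>X\<close> and its gradient is a polynomial in the other. A subspace that contains the identity and is
  closed under the Jordan product is closed under polynomials
  (\<open>jordan_subspace_polynomial_closed\<close>), which gives both directions.
\<close>

section \<open>Bilinearity of the matrix product\<close>

lemma matrix_diff_ldistrib: "A ** (B - C) = A ** B - A ** C" for A :: "real^'n^'m"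
  by (simp add: vec_eq_iff matrix_matrix_mult_def sum_subtractf algebra_simps)

lemma matrix_diff_rdistrib: "(A - B) ** C = A ** C - B ** C" for A :: "real^'n^'m"
  by (simp add: vec_eq_iff matrix_matrix_mult_def sum_subtractf algebra_simps)

lemma matrix_add_rdistrib_real: "(A + B) ** C = A ** C + B ** C" for A :: "real^'n^'m"
  by (simp add: vec_eq_iff matrix_matrix_mult_def sum.distrib algebra_simps)

section \<open>The spectral theorem for real symmetric matrices\<close>

text \<open>The eigenvector is a maximizer of the Rayleigh quotient on the unit sphere of \<open>S\<close>; the first
  variation in the directions of \<open>S\<close> orthogonal to it vanishes.\<close>

lemma self_adjoint_eigenvector_in_subspace:
  fixes f :: "'a::euclidean_space \<Rightarrow> 'a"
  assumes f: "linear f" and self_adj: "\<And>x y. f x \<bullet> y = x \<bullet> f y"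
    and S: "subspace S" and inv: "\<And>x. x \<in> S \<Longrightarrow> f x \<in> S"
    and nontriv: "x0 \<in> S" "x0 \<noteq> 0"
  obtains v c where "v \<in> S" "norm v = 1" "f v = c *\<^sub>R v"
proof -
  let ?K = "S \<inter> sphere 0 1"
  have "compact ?K"
    using S by (simp add: closed_Int_compact closed_subspace)
  moreover have "x0 /\<^sub>R norm x0 \<in> ?K"
    using nontriv S by (simp add: subspace_scale)
  moreover have "continuous_on ?K (\<lambda>x. x \<bullet> f x)"
    by (intro continuous_intros linear_continuous_on linear_conv_bounded_linear[THEN iffD1] f)
  ultimately obtain v where v: "v \<in> ?K" and vmax: "\<And>y. y \<in> ?K \<Longrightarrow> y \<bullet> f y \<le> v \<bullet> f v"
    using continuous_attains_sup[of ?K "\<lambda>x. x \<bullet> f x"] by blast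
  define c where "c = v \<bullet> f v"
  have vS: "v \<in> S" and vv: "v \<bullet> v = 1"
    using v by (auto simp: dot_square_norm)
  have bound: "y \<bullet> f y \<le> c * (y \<bullet> y)" if "y \<in> S" for y
  proof (cases "y = 0")
    case False
    have "y /\<^sub>R norm y \<in> ?K"
      using that False S by (simp add: subspace_scale)
    from vmax[OF this] have "(y \<bullet> f y) / (norm y)\<^sup>2 \<le> c"
      using f by (simp add: c_def linear_cmul power2_eq_square divide_inverse mult_ac)
    then show ?thesis
      using False by (simp add: divide_simps dot_square_norm mult.commute)
  qed (simp add: linear_0 f)
  have orth: "w \<bullet> f v = 0" if w: "w \<in> S" "w \<bullet> v = 0" for w
  proof -
    define \<alpha> where "\<alpha> = w \<bullet> f v"
    define k where "k = c * (w \<bullet> w) - w \<bullet> f w"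
    have quad: "2 * t * \<alpha> \<le> t\<^sup>2 * k" for t
    proof -
      have "v + t *\<^sub>R w \<in> S"
        using vS w S by (simp add: subspace_add subspace_scale)
      moreover have "v \<bullet> f w = \<alpha>"
        using self_adj[of v w] by (simp add: \<alpha>_def inner_commute)
      ultimately show ?thesis
        using bound[of "v + t *\<^sub>R w"] w(2) vv f
        by (simp add: linear_add linear_cmul inner_add_left inner_add_right k_def \<alpha>_def c_def
            inner_commute[of v w] power2_eq_square algebra_simps)
    qed
    have "k \<ge> 0"
      using bound[OF w(1)] by (simp add: k_def)
    \<comment> \<open>With this \<open>t\<close>, \<open>quad\<close> becomes \<open>t\<^sup>2 * (2 + k) \<le> 0\<close>, also when \<open>k = 0\<close>.\<close>
    define t where "t = \<alpha> / (1 + k)"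
    have "\<alpha> = t * (1 + k)"
      using \<open>k \<ge> 0\<close> by (simp add: t_def)
    with quad[of t] have "t\<^sup>2 * (2 + k) \<le> 0"
      by (simp add: power2_eq_square algebra_simps)
    then have "\<alpha> = 0"
      using \<open>k \<ge> 0\<close> \<open>\<alpha> = t * (1 + k)\<close> by (simp add: mult_le_0_iff)
    then show ?thesis
      by (simp add: \<alpha>_def)
  qed
  define u where "u = f v - c *\<^sub>R v"
  have uv: "u \<bullet> v = 0"
    by (simp add: u_def inner_diff_left c_def vv inner_commute[of "f v" v])
  moreover have "u \<in> S"
    using vS S inv by (simp add: u_def subspace_diff subspace_scale)
  ultimately have "u \<bullet> f v = 0"
    by (rule orth[rotated])
  then have "u \<bullet> u = 0"
    using uv by (metis inner_diff_right inner_scaleR_right mult_zero_right diff_zero u_def)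
  then have "f v = c *\<^sub>R v"
    by (simp add: u_def)
  then show thesis
    using that v by auto
qed

text \<open>An orthonormal set of eigenvectors of maximal cardinality is a basis: its orthogonal complement
  is invariant, so if it were nontrivial it would contain a further eigenvector.\<close>

lemma self_adjoint_orthonormal_eigenbasis:
  fixes f :: "'a::euclidean_space \<Rightarrow> 'a"
  assumes f: "linear f" and self_adj: "\<And>x y. f x \<bullet> y = x \<bullet> f y"
  obtains B where "finite B" "card B = DIM('a)" "pairwise orthogonal B"
    "\<And>b. b \<in> B \<Longrightarrow> norm b = 1" "\<And>b. b \<in> B \<Longrightarrow> \<exists>c. f b = c *\<^sub>R b"
proof -
  define P where "P B \<longleftrightarrow> pairwise orthogonal B \<and> (\<forall>b\<in>B. norm b = 1 \<and> (\<exists>c. f b = c *\<^sub>R b))"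
    for B :: "'a set"
  have indep: "independent B" if "P B" for B
    using that by (intro pairwise_orthogonal_independent) (auto simp: P_def)
  have bounded: "finite B \<and> card B \<le> DIM('a)" if "P B" for B
    using independent_bound[OF indep[OF that]] .
  have "P {}"
    by (simp add: P_def)
  then obtain B where B: "P B" and Bmax: "\<And>C. P C \<Longrightarrow> card C \<le> card B"
    using ex_has_greatest_nat[of P "{}" card "DIM('a)"] bounded by fastforce
  have "card B = DIM('a)"
  proof (rule ccontr)
    assume "card B \<noteq> DIM('a)"
    then have "dim B < DIM('a)"
      using bounded[OF B] indep[OF B] by (simp add: dim_eq_card_independent)
    then obtain x where x: "x \<noteq> 0" "\<And>y. y \<in> span B \<Longrightarrow> orthogonal x y"
      using orthogonal_to_subspace_exists by blast
    let ?S = "{y. \<forall>b\<in>B. y \<bullet> b = 0}"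
    have "subspace ?S"
      by (auto simp: subspace_def inner_add_left)
    moreover have "f y \<in> ?S" if "y \<in> ?S" for y
      using that B self_adj by (force simp: P_def)
    moreover have "x \<in> ?S"
      using x(2) by (auto simp: orthogonal_def span_base)
    ultimately obtain v c where v: "v \<in> ?S" "norm v = 1" "f v = c *\<^sub>R v"
      by (rule self_adjoint_eigenvector_in_subspace[OF f self_adj _ _ _ x(1)])
    have "v \<notin> B"
      using v(1,2) by (auto simp: dot_square_norm)
    have "P (insert v B)"
      using B v by (auto simp: P_def pairwise_insert orthogonal_def inner_commute)
    from Bmax[OF this] show False
      using \<open>v \<notin> B\<close> bounded[OF B] by simp
  qed
  then show thesis
    using that[of B] B bounded[OF B] by (auto simp: P_def)
qed

text \<open>The diagonal matrix with the diagonal entries \<open>d i\<close>, given as a function on the index type.\<close>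

definition diag_mat :: "('m \<Rightarrow> real) \<Rightarrow> real^'m^'m" where
  "diag_mat d = (\<chi> i j. if i = j then d i else 0)"

lemma matrix_mult_diag_mat: "(A ** diag_mat d) $ i $ j = A $ i $ j * d j"
  by (simp add: matrix_matrix_mult_def diag_mat_def if_distrib[of "\<lambda>x. _ * x"] cong: if_cong)

lemma diag_mat_matrix_mult: "(diag_mat d ** A) $ i $ j = d i * A $ i $ j"
  by (simp add: matrix_matrix_mult_def diag_mat_def if_distrib[of "\<lambda>x. x * _"] cong: if_cong)

lemma transpose_diag_mat [simp]: "transpose (diag_mat d) = diag_mat d"
  by (simp add: diag_mat_def transpose_def vec_eq_iff)

lemma diag_mat_mult: "diag_mat d ** diag_mat e = diag_mat (\<lambda>i. d i * e i)"
  by (simp add: vec_eq_iff matrix_mult_diag_mat) (simp add: diag_mat_def)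

lemma diag_mat_add: "diag_mat d + diag_mat e = diag_mat (\<lambda>i. d i + e i)"
  by (simp add: vec_eq_iff diag_mat_def)

lemma diag_mat_scaleR: "c *\<^sub>R diag_mat d = diag_mat (\<lambda>i. c * d i)"
  by (simp add: vec_eq_iff diag_mat_def)

lemma diag_mat_const: "diag_mat (\<lambda>i. c) = c *\<^sub>R mat 1"
  by (simp add: vec_eq_iff diag_mat_def mat_def)

lemma diag_mat_sym [simp]: "diag_mat d \<in> sym_mats"
  by (simp add: sym_mats_def)

lemma symmetric_orthogonally_diagonalizable:
  fixes A :: "real^'m^'m"
  assumes "A \<in> sym_mats"
  obtains U d where "orthogonal_matrix U" "A = U ** diag_mat d ** transpose U"
proof -
  have tA: "transpose A = A"
    using assms by (simp add: sym_mats_def)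
  have self_adj: "(A *v x) \<bullet> y = x \<bullet> (A *v y)" for x y
    using dot_lmul_matrix[of x A y] transpose_matrix_vector[of A x] by (simp add: tA)
  obtain B where B: "finite B" "card B = DIM(real^'m)" "pairwise orthogonal B"
    "\<And>b. b \<in> B \<Longrightarrow> norm b = 1" "\<And>b. b \<in> B \<Longrightarrow> \<exists>c. A *v b = c *\<^sub>R b"
    using self_adjoint_orthonormal_eigenbasis[OF matrix_vector_mul_linear self_adj] by blast
  have "card (UNIV :: 'm set) = card B"
    using B(2) by simp
  then obtain g where g: "bij_betw g (UNIV :: 'm set) B"
    using finite_same_card_bij[OF finite_class.finite_UNIV B(1)] by blast
  have gB: "g i \<in> B" for i
    using g by (auto simp: bij_betw_def)
  obtain d where d: "\<And>i. A *v g i = d i *\<^sub>R g i"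
    using B(5)[OF gB] by metis
  define U where "U = (\<chi> i j. g j $ i)"
  have col: "column j U = g j" for j
    by (simp add: U_def column_def vec_eq_iff)
  have "inj g"
    using g by (simp add: bij_betw_def)
  then have orth: "orthogonal_matrix U"
    using B(3,4) gB by (auto simp: orthogonal_matrix_orthonormal_columns col pairwise_def inj_eq)
  have "A ** U = U ** diag_mat d"
  proof -
    have "(A ** U) $ i $ j = (A *v g j) $ i" for i j
      by (simp add: matrix_matrix_mult_def matrix_vector_mult_def U_def)
    then show ?thesis
      by (simp add: vec_eq_iff matrix_mult_diag_mat d) (simp add: U_def mult.commute)
  qed
  then have "A = U ** diag_mat d ** transpose U"
    using orth by (simp add: orthogonal_matrix_def flip: matrix_mul_assoc)
       (metis matrix_mul_assoc matrix_mul_rid)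
  then show thesis
    using that orth by blast
qed

section \<open>Spectral functions\<close>

lemma poly_char_polynomial:
  fixes A :: "real^'m^'m"
  shows "poly (char_polynomial A) x = det (x *\<^sub>R mat 1 - A)"
proof -
  have "poly (of_int (sign p)) x = (of_int (sign p) :: real)" for p :: "'m \<Rightarrow> 'm"
    by (simp add: sign_def)
  then show ?thesis
    unfolding char_polynomial_def det_def poly_sum poly_mult poly_prod
    by (intro sum.cong prod.cong arg_cong2[where f = "(*)"]) (auto simp: mat_def)
qed

lemma orthogonal_conj_cancel:
  fixes Q :: "real^'m^'m"
  assumes "orthogonal_matrix Q"
  shows "transpose Q ** (Q ** A ** transpose Q) ** Q = A"
proof -
  have "transpose Q ** (Q ** A ** transpose Q) ** Q = (transpose Q ** Q) ** A ** (transpose Q ** Q)"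
    by (simp add: matrix_mul_assoc)
  then show ?thesis
    using assms by (simp add: orthogonal_matrix_def)
qed

lemma char_polynomial_orthogonal_conj:
  fixes Q A :: "real^'m^'m"
  assumes "orthogonal_matrix Q"
  shows "char_polynomial (Q ** A ** transpose Q) = char_polynomial A"
proof -
  have "det (x *\<^sub>R mat 1 - Q ** A ** transpose Q) = det (x *\<^sub>R mat 1 - A)" for x
  proof -
    have "x *\<^sub>R mat 1 - Q ** A ** transpose Q = Q ** (x *\<^sub>R mat 1 - A) ** transpose Q"
    proof -
      have "Q ** (x *\<^sub>R mat 1 - A) ** transpose Q
          = x *\<^sub>R (Q ** transpose Q) - Q ** A ** transpose Q"
        by (simp add: matrix_diff_ldistrib matrix_diff_rdistrib scalar_matrix_assoc[symmetric]
            matrix_scalar_ac)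
      then show ?thesis
        using assms by (simp add: orthogonal_matrix_def)
    qed
    moreover have "det Q * det (transpose Q) = 1"
      using assms by (metis det_I det_mul orthogonal_matrix_def)
    ultimately show ?thesis
      by (simp add: det_mul mult.commute mult.left_commute)
  qed
  then show ?thesis
    by (simp add: poly_eq_poly_eq_iff[symmetric] fun_eq_iff poly_char_polynomial)
qed

lemma trace_matrix_fun_orthogonal_conj:
  assumes "orthogonal_matrix Q"
  shows "trace_matrix_fun \<phi> (Q ** A ** transpose Q) = trace_matrix_fun \<phi> A"
  by (simp add: trace_matrix_fun_def eigenvalues_mset_def char_polynomial_orthogonal_conj assms)

lemma trace_matrix_fun_diag_mat:
  "trace_matrix_fun \<phi> (diag_mat d) = (\<Sum>i\<in>UNIV. \<phi> (d i))"
proof -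
  have "char_polynomial (diag_mat d) = (\<Prod>i\<in>UNIV. [:- d i, 1:])"
    unfolding char_polynomial_def by (subst det_diagonal) (auto simp: diag_mat_def)
  then have "eigenvalues_mset (diag_mat d) = (\<Sum>i\<in>UNIV. {#d i#})"
    by (simp add: eigenvalues_mset_def proots_prod)
  moreover have "(\<Sum>x\<in>#(\<Sum>i\<in>I. {#d i#}). \<phi> x) = (\<Sum>i\<in>I. \<phi> (d i))" if "finite I" for I
    using that by (induction I) auto
  ultimately show ?thesis
    by (simp add: trace_matrix_fun_def)
qed

section \<open>Gradients on the symmetric matrices\<close>

lemma subspace_sym_mats: "subspace sym_mats"
  by (auto simp: subspace_def sym_mats_def transpose_def vec_eq_iff)

lemma sym_mats_conj:
  assumes "A \<in> sym_mats"
  shows "Q ** A ** transpose Q \<in> sym_mats"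
  using assms by (simp add: sym_mats_def matrix_transpose_mul matrix_mul_assoc)

text \<open>The gradient yields ordinary directional derivatives along symmetric directions, as the line
  stays in \<open>sym_mats\<close>.\<close>

lemma has_sym_gradient_directional:
  assumes G: "has_sym_gradient F G A" and A: "A \<in> sym_mats" and H: "H \<in> sym_mats"
  shows "((\<lambda>t. real_of_ereal (F (A + t *\<^sub>R H))) has_real_derivative trace (G ** H)) (at 0)"
proof -
  let ?D = "\<lambda>H. trace (G ** H)"
  have D: "((\<lambda>X. real_of_ereal (F X)) has_derivative ?D) (at A within sym_mats)"
    using G by (simp add: has_sym_gradient_def)
  have line: "((\<lambda>t. A + t *\<^sub>R H) has_derivative (\<lambda>t. t *\<^sub>R H)) (at 0)"
    by (auto intro!: derivative_eq_intros)
  have "range (\<lambda>t. A + t *\<^sub>R H) \<subseteq> sym_mats"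
    using A H by (auto intro!: subspace_add subspace_scale subspace_sym_mats)
  then have D': "((\<lambda>X. real_of_ereal (F X)) has_derivative ?D)
      (at (A + 0 *\<^sub>R H) within range (\<lambda>t. A + t *\<^sub>R H))"
    using has_derivative_subset[OF D] by simp
  have "((\<lambda>t. real_of_ereal (F (A + t *\<^sub>R H))) has_derivative (\<lambda>t. ?D (t *\<^sub>R H))) (at 0)"
    using has_derivative_in_compose[OF line D'] .
  moreover have "(\<lambda>t. ?D (t *\<^sub>R H)) = (\<lambda>t. trace (G ** H) * t)"
    using linear_cmul[OF has_derivative_linear[OF D], of _ H] by (auto simp: mult.commute)
  ultimately show ?thesis
    by (simp add: has_field_derivative_def)
qed

text \<open>Two gradients are compared along their own difference \<open>M\<close>, which is symmetric; then
  \<open>trace (M ** transpose M)\<close>, the sum of the squares of the entries of \<open>M\<close>, vanishes.\<close>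

lemma has_sym_gradient_unique:
  assumes G: "has_sym_gradient F G A" and G': "has_sym_gradient F G' A" and A: "A \<in> sym_mats"
  shows "G = G'"
proof -
  define M where "M = G - G'"
  have M: "M \<in> sym_mats"
    using G G' by (simp add: M_def has_sym_gradient_def subspace_diff subspace_sym_mats)
  have "trace (G ** M) = trace (G' ** M)"
    using has_sym_gradient_directional[OF G A M] has_sym_gradient_directional[OF G' A M]
    by (rule DERIV_unique)
  moreover have "M ** transpose M = G ** M - G' ** M"
    using M by (simp add: sym_mats_def) (simp add: M_def matrix_diff_rdistrib)
  ultimately have "trace (M ** transpose M) = 0"
    by (simp add: trace_sub)
  then have "(\<Sum>i\<in>UNIV. \<Sum>j\<in>UNIV. (M $ i $ j)\<^sup>2) = 0"
    by (simp add: trace_def matrix_matrix_mult_def transpose_def power2_eq_square)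
  then have "M = 0"
    by (simp add: sum_nonneg_eq_0_iff sum_nonneg vec_eq_iff)
  then show ?thesis
    by (simp add: M_def)
qed

lemma sym_gradient_eqI:
  assumes "has_sym_gradient F G A" "A \<in> sym_mats"
  shows "sym_gradient F A = G"
  unfolding sym_gradient_def using assms has_sym_gradient_unique by blast

lemma has_sym_gradient_orthogonal_conj:
  fixes F :: "real^'m^'m \<Rightarrow> ereal"
  assumes G: "has_sym_gradient F G A" and A: "A \<in> sym_mats"
    and Q: "orthogonal_matrix Q"
    and inv: "\<And>X. X \<in> sym_mats \<Longrightarrow> F (transpose Q ** X ** Q) = F X"
  shows "has_sym_gradient F (Q ** G ** transpose Q) (Q ** A ** transpose Q)"
proof -
  let ?c = "\<lambda>X. transpose Q ** X ** Q"
  have D: "((\<lambda>X. real_of_ereal (F X)) has_derivative (\<lambda>H. trace (G ** H))) (at A within sym_mats)"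
    using G by (simp add: has_sym_gradient_def)
  have "linear ?c"
    by (rule linearI) (simp_all add: matrix_add_ldistrib matrix_add_rdistrib_real
        scalar_matrix_assoc[symmetric] matrix_scalar_ac)
  then have c: "(?c has_derivative ?c) (at (Q ** A ** transpose Q) within sym_mats)"
    by (simp add: linear_imp_has_derivative has_derivative_at_withinI)
  have sub: "?c ` sym_mats \<subseteq> sym_mats"
    using sym_mats_conj[of _ "transpose Q"] by auto
  have "((\<lambda>X. real_of_ereal (F X)) has_derivative (\<lambda>H. trace (G ** H)))
      (at (?c (Q ** A ** transpose Q)) within ?c ` sym_mats)"
    using has_derivative_subset[OF D sub] by (simp add: orthogonal_conj_cancel[OF Q])
  from has_derivative_in_compose[OF c this]
  have "((\<lambda>X. real_of_ereal (F (?c X))) has_derivative (\<lambda>H. trace (G ** ?c H)))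
      (at (Q ** A ** transpose Q) within sym_mats)" .
  moreover have "trace (G ** ?c H) = trace (Q ** G ** transpose Q ** H)" for H
    using trace_mul_sym[of "G ** transpose Q ** H" Q] by (simp add: matrix_mul_assoc)
  ultimately have "((\<lambda>X. real_of_ereal (F (?c X))) has_derivative
      (\<lambda>H. trace (Q ** G ** transpose Q ** H))) (at (Q ** A ** transpose Q) within sym_mats)"
    by simp
  then have "((\<lambda>X. real_of_ereal (F X)) has_derivative
      (\<lambda>H. trace (Q ** G ** transpose Q ** H))) (at (Q ** A ** transpose Q) within sym_mats)"
    by (rule has_derivative_transform[rotated 2]) (simp_all add: inv sym_mats_conj A)
  then show ?thesis
    using G by (simp add: has_sym_gradient_def sym_mats_conj)
qed


section \<open>The gradient of a spectral function\<close>

lemma orthogonal_matrix_flip: "orthogonal_matrix (diag_mat (\<lambda>k. if k = i then -1 else 1))"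
proof -
  have "(\<lambda>k. (if k = i then -1 else 1) * (if k = i then -1 else 1 :: real)) = (\<lambda>k. 1)"
    by auto
  then show ?thesis
    by (simp add: orthogonal_matrix diag_mat_mult diag_mat_const)
qed

text \<open>Conjugation with a sign flip of one coordinate fixes \<open>diag_mat d\<close>, hence also the gradient
  there, and this kills the off-diagonal entries.\<close>

lemma spectral_gradient_at_diag_mat_is_diagonal:
  fixes F :: "real^'m^'m \<Rightarrow> ereal"
  assumes spectral: "\<And>A. A \<in> sym_mats \<Longrightarrow> F A = trace_matrix_fun \<phi> A"
    and D: "has_sym_gradient F D (diag_mat d)"
  shows "D = diag_mat (\<lambda>i. D $ i $ i)"
proof -
  have "D $ i $ j = 0" if "i \<noteq> j" for i j
  proof -
    define s where "s k = (if k = i then -1 else 1 :: real)" for k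
    have Q: "orthogonal_matrix (diag_mat s)"
      unfolding s_def by (rule orthogonal_matrix_flip)
    have s2: "s k * c * s k = c" for k c
      by (simp add: s_def)
    have inv: "F (transpose (diag_mat s) ** X ** diag_mat s) = F X" if "X \<in> sym_mats" for X
      using trace_matrix_fun_orthogonal_conj[OF Q, of \<phi> X] sym_mats_conj[OF that, of "diag_mat s"]
        that by (simp add: spectral)
    have "diag_mat s ** D ** diag_mat s = D"
      using has_sym_gradient_orthogonal_conj[OF D _ Q inv] D
      by (intro has_sym_gradient_unique[of F _ "diag_mat d"]) (simp_all add: diag_mat_mult s2)
    then have "(diag_mat s ** D ** diag_mat s) $ i $ j = D $ i $ j"
      by simp
    then show ?thesis
      using that by (simp add: matrix_mult_diag_mat diag_mat_matrix_mult s_def)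
  qed
  then show ?thesis
    by (simp add: vec_eq_iff) (simp add: diag_mat_def)
qed

lemma real_spectral_diag_mat:
  assumes spectral: "\<And>A. A \<in> sym_mats \<Longrightarrow> F A = trace_matrix_fun \<phi> A"
    and minf: "\<And>x. \<phi> x \<noteq> -\<infinity>"
    and fin: "\<And>x. 0 < x \<Longrightarrow> \<phi> x \<noteq> \<infinity>"
    and pos: "\<And>i. 0 < d i"
  shows "F (diag_mat d) = ereal (\<Sum>i\<in>UNIV. real_of_ereal (\<phi> (d i)))"
proof -
  have "\<phi> (d i) = ereal (real_of_ereal (\<phi> (d i)))" for i
    using minf[of "d i"] fin[OF pos[of i]] by (cases "\<phi> (d i)") auto
  then show ?thesis
    by (simp add: spectral trace_matrix_fun_diag_mat flip: sum_ereal)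
qed

text \<open>Along the \<open>i\<close>-th diagonal unit matrix, \<open>F\<close> is \<open>\<phi>\<close> of the \<open>i\<close>-th entry plus a constant, as long
  as that entry stays positive.\<close>

lemma spectral_gradient_diagonal_entry:
  fixes F :: "real^'m^'m \<Rightarrow> ereal"
  assumes spectral: "\<And>A. A \<in> sym_mats \<Longrightarrow> F A = trace_matrix_fun \<phi> A"
    and minf: "\<And>x. \<phi> x \<noteq> -\<infinity>"
    and fin: "\<And>x. 0 < x \<Longrightarrow> \<phi> x \<noteq> \<infinity>"
    and pos: "\<And>i. 0 < d i"
    and D: "has_sym_gradient F D (diag_mat d)"
  shows "((\<lambda>x. real_of_ereal (\<phi> x)) has_real_derivative D $ i $ i) (at (d i))"
proof -
  define g where "g x = real_of_ereal (\<phi> x)" for x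
  define E where "E = diag_mat (\<lambda>k. if k = i then 1 else 0)"
  define c where "c = (\<Sum>k\<in>UNIV - {i}. g (d k))"
  have "trace (D ** E) = D $ i $ i"
    by (simp add: trace_def E_def matrix_mult_diag_mat if_distrib[of "\<lambda>x. _ * x"] cong: if_cong)
  then have "((\<lambda>t. real_of_ereal (F (diag_mat d + t *\<^sub>R E))) has_real_derivative D $ i $ i) (at 0)"
    using has_sym_gradient_directional[OF D, of E] by (simp add: E_def)
  moreover have "real_of_ereal (F (diag_mat d + t *\<^sub>R E)) = g (t + d i) + c" if "t \<in> {- d i<..}" for t
  proof -
    define e where "e k = d k + (if k = i then t else 0)" for k
    have e: "diag_mat d + t *\<^sub>R E = diag_mat e"
      by (simp add: vec_eq_iff E_def e_def diag_mat_def)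
    have "0 < e k" for k
      using that pos[of k] by (auto simp: e_def)
    then have "real_of_ereal (F (diag_mat e)) = (\<Sum>k\<in>UNIV. g (e k))"
      using real_spectral_diag_mat[of F \<phi> e] spectral minf fin by (simp add: g_def)
    also have "\<dots> = g (e i) + (\<Sum>k\<in>UNIV - {i}. g (e k))"
      by (rule sum.remove) auto
    also have "\<dots> = g (t + d i) + c"
      by (simp add: c_def e_def add.commute)
    finally show ?thesis
      by (simp add: e)
  qed
  ultimately have "((\<lambda>t. g (t + d i) + c) has_real_derivative D $ i $ i) (at 0)"
    using has_field_derivative_transform_within_open[of _ _ 0 "{- d i<..}"] pos[of i] by simp
  from DERIV_diff[OF this DERIV_const[of c]]
  have "((\<lambda>t. g (t + d i)) has_real_derivative D $ i $ i) (at 0)"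
    by simp
  then have "(g has_real_derivative D $ i $ i) (at (d i))"
    using DERIV_shift[of g "D $ i $ i" 0 "d i"] by simp
  then show ?thesis
    unfolding g_def .
qed

section \<open>Injectivity of the derivative of a strictly convex function\<close>

lemma scalar_mat_pos_def: "0 < c \<Longrightarrow> diag_mat (\<lambda>i. c) \<in> pos_def_mats"
  by (simp add: pos_def_mats_def) (simp add: diag_mat_const flip: scaleR_matrix_vector_assoc)

text \<open>At \<open>x\<close> times the identity, \<open>F\<close> takes the value \<open>CARD('m) * \<phi> x\<close>, so \<open>\<phi>\<close> inherits the strict
  convexity of \<open>F\<close>.\<close>

lemma spectral_profile_strictly_convex:
  fixes F :: "real^'m^'m \<Rightarrow> ereal"
  assumes F: "F \<in> convex_class"
    and spectral: "\<And>A. A \<in> sym_mats \<Longrightarrow> F A = trace_matrix_fun \<phi> A"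
    and minf: "\<And>x. \<phi> x \<noteq> -\<infinity>"
    and fin: "\<And>x. 0 < x \<Longrightarrow> \<phi> x \<noteq> \<infinity>"
    and ab: "0 < a" "0 < b" "a \<noteq> b" and t: "0 < t" "t < 1"
  shows "real_of_ereal (\<phi> ((1 - t) * a + t * b))
    < (1 - t) * real_of_ereal (\<phi> a) + t * real_of_ereal (\<phi> b)"
proof -
  define g where "g x = real_of_ereal (\<phi> x)" for x
  let ?S = "\<lambda>x. diag_mat (\<lambda>i. x) :: real^'m^'m"
  have F_scalar: "F (?S x) = ereal (real CARD('m) * g x)" if "0 < x" for x
    using real_spectral_diag_mat[of F \<phi> "\<lambda>i. x"] spectral minf fin that by (simp add: g_def)
  have "?S a \<noteq> ?S b"
    using ab(3) by (simp add: diag_mat_def vec_eq_iff)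
  moreover have "\<forall>A\<in>pos_def_mats. \<forall>B\<in>pos_def_mats. \<forall>t::real. A \<noteq> B \<and> 0 < t \<and> t < 1 \<longrightarrow>
      F ((1 - t) *\<^sub>R A + t *\<^sub>R B) < ereal (1 - t) * F A + ereal t * F B"
    using F unfolding convex_class_def mem_Collect_eq by (elim conjE)
  ultimately have "F ((1 - t) *\<^sub>R ?S a + t *\<^sub>R ?S b)
      < ereal (1 - t) * F (?S a) + ereal t * F (?S b)"
    using scalar_mat_pos_def ab t by blast
  moreover have "(1 - t) *\<^sub>R ?S a + t *\<^sub>R ?S b = ?S ((1 - t) * a + t * b)"
    by (simp add: diag_mat_scaleR diag_mat_add)
  moreover have "0 < (1 - t) * a + t * b"
    using ab t by (simp add: add_pos_pos)
  ultimately have "real CARD('m) * g ((1 - t) * a + t * b)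
      < (1 - t) * (real CARD('m) * g a) + t * (real CARD('m) * g b)"
    using ab by (simp add: F_scalar)
  then have "real CARD('m) * g ((1 - t) * a + t * b) < real CARD('m) * ((1 - t) * g a + t * g b)"
    by (simp add: algebra_simps)
  then show ?thesis
    by (simp add: g_def)
qed

text \<open>If the slopes at \<open>a\<close> and \<open>b\<close> agree, the two tangents bound \<open>g\<close> at the midpoint from below by
  the value on the chord, against strict convexity.\<close>

lemma strictly_convex_derivative_inj:
  fixes g :: "real \<Rightarrow> real"
  assumes sc: "\<And>x y t. 0 < x \<Longrightarrow> 0 < y \<Longrightarrow> x \<noteq> y \<Longrightarrow> 0 < t \<Longrightarrow> t < 1
      \<Longrightarrow> g ((1 - t) * x + t * y) < (1 - t) * g x + t * g y"
    and a: "0 < a" "(g has_real_derivative m) (at a)"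
    and b: "0 < b" "(g has_real_derivative m) (at b)"
  shows "a = b"
proof (rule ccontr)
  assume "a \<noteq> b"
  have "convex_on {0<..} g"
  proof (rule convex_onI)
    fix t x y :: real
    assume *: "0 < t" "t < 1" "x \<in> {0<..}" "y \<in> {0<..}"
    show "g ((1 - t) *\<^sub>R x + t *\<^sub>R y) \<le> (1 - t) * g x + t * g y"
      using sc[of x y t] * by (cases "x = y") (auto simp: algebra_simps)
  qed simp
  then have tangent: "g y - g x \<ge> m * (y - x)"
    if "0 < x" "0 < y" "(g has_real_derivative m) (at x)" for x y
    using that by (intro convex_on_imp_above_tangent[of "{0<..}"])
      (auto simp: interior_open has_field_derivative_at_within)
  define c where "c = (1 - 1/2) * a + 1/2 * b"
  have "g c < (1 - 1/2) * g a + 1/2 * g b"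
    unfolding c_def using a b \<open>a \<noteq> b\<close> by (intro sc) auto
  moreover have "g c - g a \<ge> m * (c - a)"
    using a b by (intro tangent) (auto simp: c_def)
  moreover have "g a - g b \<ge> m * (a - b)"
    using a b by (intro tangent)
  ultimately show False
    by (simp add: c_def algebra_simps)
qed

section \<open>Jordan algebras of symmetric matrices are closed under polynomials\<close>

text \<open>The nodes \<open>d i\<close> may repeat, provided that the prescribed values agree wherever they do.\<close>

lemma polynomial_interpolation:
  fixes d e :: "'i \<Rightarrow> 'a::field"
  assumes "finite I" "\<And>i j. i \<in> I \<Longrightarrow> j \<in> I \<Longrightarrow> d i = d j \<Longrightarrow> e i = e j"
  shows "\<exists>p. \<forall>i\<in>I. poly p (d i) = e i"
  using assms
proof (induction I)
  case (insert k I)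
  then obtain p where p: "\<And>i. i \<in> I \<Longrightarrow> poly p (d i) = e i"
    by auto
  show ?case
  proof (cases "d k \<in> d ` I")
    case True
    then have "poly p (d k) = e k"
      using p insert.prems by (metis imageE insertCI)
    then show ?thesis
      using p by (intro exI[of _ p]) auto
  next
    case False
    define q where "q = (\<Prod>x\<in>d ` I. [:- x, 1:])"
    have "poly q (d k) \<noteq> 0" and q: "\<And>i. i \<in> I \<Longrightarrow> poly q (d i) = 0"
      using insert.hyps(1) False by (auto simp: q_def poly_prod)
    then have "poly (p + smult ((e k - poly p (d k)) / poly q (d k)) q) (d i) = e i"
      if "i \<in> insert k I" for i
      using that p by auto
    then show ?thesis
      by blast
  qed
qed simp

lemma orthogonal_conj_mult:
  fixes U :: "real^'m^'m"
  assumes "orthogonal_matrix U"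
  shows "(U ** A ** transpose U) ** (U ** B ** transpose U) = U ** (A ** B) ** transpose U"
proof -
  have "(U ** A ** transpose U) ** (U ** B ** transpose U)
      = U ** A ** (transpose U ** U) ** B ** transpose U"
    by (simp add: matrix_mul_assoc)
  also have "transpose U ** U = mat 1"
    using assms by (simp add: orthogonal_matrix_def)
  finally show ?thesis
    by (simp add: matrix_mul_assoc)
qed

text \<open>In Horner form, \<open>p = pCons a q\<close> adds \<open>a\<close> times the identity to the product of \<open>A\<close> and
  \<open>q(A)\<close>. These two commute, so their matrix product is their Jordan product. The value of \<open>p\<close> at
  the matrix is expressed through a diagonalization.\<close>

lemma jordan_subspace_polynomial_closed:
  fixes L :: "(real^'m^'m) set"
  assumes L: "subspace L" "mat 1 \<in> L"
    and jordan: "\<And>A B. A \<in> L \<Longrightarrow> B \<in> L \<Longrightarrow> (1/2) *\<^sub>R (A ** B + B ** A) \<in> L"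
    and U: "orthogonal_matrix U" and A: "U ** diag_mat d ** transpose U \<in> L"
  shows "U ** diag_mat (\<lambda>i. poly p (d i)) ** transpose U \<in> L"
proof (induction p)
  case 0
  have "diag_mat (\<lambda>i. 0) = (0 :: real^'m^'m)"
    by (simp add: diag_mat_const)
  then show ?case
    using L(1) by (simp add: subspace_0)
next
  case (pCons a q)
  let ?c = "\<lambda>d. U ** diag_mat d ** transpose U"
  have "(1/2) *\<^sub>R (?c d ** ?c (\<lambda>i. poly q (d i)) + ?c (\<lambda>i. poly q (d i)) ** ?c d)
      = ?c (\<lambda>i. d i * poly q (d i))"
    by (simp add: orthogonal_conj_mult[OF U] diag_mat_mult mult.commute flip: scaleR_2)
  then have "?c (\<lambda>i. d i * poly q (d i)) \<in> L"
    using jordan[OF A pCons.IH] by simp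
  then have "a *\<^sub>R mat 1 + ?c (\<lambda>i. d i * poly q (d i)) \<in> L"
    using L by (simp add: subspace_add subspace_scale)
  moreover have "a *\<^sub>R mat 1 + ?c (\<lambda>i. d i * poly q (d i)) = ?c (\<lambda>i. a + d i * poly q (d i))"
  proof -
    have "?c (\<lambda>i. a + d i * poly q (d i))
        = U ** (a *\<^sub>R mat 1 + diag_mat (\<lambda>i. d i * poly q (d i))) ** transpose U"
      by (simp add: diag_mat_add flip: diag_mat_const)
    also have "\<dots> = a *\<^sub>R (U ** transpose U) + ?c (\<lambda>i. d i * poly q (d i))"
      by (simp add: matrix_add_ldistrib matrix_add_rdistrib_real matrix_scalar_ac
          flip: scalar_matrix_assoc)
    finally show ?thesis
      using U by (simp add: orthogonal_matrix_def)
  qed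
  ultimately show ?case
    by simp
qed

section \<open>Membership of a matrix and of its gradient in a Jordan algebra\<close>

lemma pos_def_eigenvalue_pos:
  fixes U :: "real^'m^'m"
  assumes U: "orthogonal_matrix U" and pd: "U ** diag_mat d ** transpose U \<in> pos_def_mats"
  shows "0 < d i"
proof -
  let ?X = "U ** diag_mat d ** transpose U"
  let ?e = "axis i 1 :: real^'m"
  have "orthogonal_transformation ((*v) U)"
    using U by (simp add: orthogonal_transformation_matrix)
  then have inner: "(U *v x) \<bullet> (U *v y) = x \<bullet> y" for x y
    by (simp add: orthogonal_transformation_def)
  have "diag_mat d *v ?e = d i *\<^sub>R ?e"
    by (auto simp: vec_eq_iff matrix_vector_mult_def diag_mat_def axis_def
        if_distrib[of "\<lambda>x. _ * x"] cong: if_cong)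
  moreover have "?X ** U = U ** diag_mat d"
    using U by (simp add: orthogonal_matrix_def flip: matrix_mul_assoc)
  ultimately have "?X *v (U *v ?e) = U *v (d i *\<^sub>R ?e)"
    by (simp add: matrix_vector_mul_assoc) (simp flip: matrix_vector_mul_assoc)
  then have "(U *v ?e) \<bullet> (?X *v (U *v ?e)) = d i"
    by (simp add: inner inner_axis_axis)
  moreover have "U *v ?e \<noteq> 0"
    using inner[of ?e ?e] by (auto simp: inner_axis_axis)
  moreover have "\<forall>x. x \<noteq> 0 \<longrightarrow> 0 < x \<bullet> (?X *v x)"
    using pd unfolding pos_def_mats_def mem_Collect_eq by (rule conjunct2)
  ultimately show ?thesis
    by metis
qed

theorem proposition8p5:
  fixes F :: "real^'m^'m \<Rightarrow> ereal"
    and \<phi> :: "real \<Rightarrow> ereal"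
    and L :: "(real^'m^'m) set"
    and X :: "real^'m^'m"
  assumes F_class: "F \<in> convex_class"
    and phi_not_minf: "\<And>x. \<phi> x \<noteq> -\<infinity>"
    and F_spectral: "\<And>A. A \<in> sym_mats \<Longrightarrow> F A = trace_matrix_fun \<phi> A"
    and phi_finite: "\<And>x. 0 < x \<Longrightarrow> \<phi> x \<noteq> \<infinity>"
    and phi_analytic: "real_analytic_on (\<lambda>x. real_of_ereal (\<phi> x)) {0<..}"
    and L_subspace: "subspace L"
    and L_sym: "L \<subseteq> sym_mats"
    and L_jordan: "\<And>A B. A \<in> L \<Longrightarrow> B \<in> L \<Longrightarrow> (1/2) *\<^sub>R (A ** B + B ** A) \<in> L"
    and L_id: "mat 1 \<in> L"
    and X_pd: "X \<in> pos_def_mats"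
  shows "X \<in> L \<inter> pos_def_mats \<longleftrightarrow> sym_gradient F X \<in> L \<inter> gradient_image F"
proof -
  have X_sym: "X \<in> sym_mats"
    using X_pd by (simp add: pos_def_mats_def)
  obtain U d where U: "orthogonal_matrix U" and X: "X = U ** diag_mat d ** transpose U"
    using symmetric_orthogonally_diagonalizable[OF X_sym] .
  have d_pos: "0 < d i" for i
    using pos_def_eigenvalue_pos[OF U] X_pd X by simp
  obtain G where G: "has_sym_gradient F G X"
    using F_class X_pd by (auto simp only: convex_class_def mem_Collect_eq)
  have U': "orthogonal_matrix (transpose U)"
    using U by simp
  define D where "D = transpose U ** G ** U"
  have inv: "F (U ** A ** transpose U) = F A" if "A \<in> sym_mats" for A
    using trace_matrix_fun_orthogonal_conj[OF U, of \<phi> A] sym_mats_conj[OF that, of U] that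
    by (simp add: F_spectral)
  have D: "has_sym_gradient F D (diag_mat d)"
    using has_sym_gradient_orthogonal_conj[OF G X_sym U'] inv orthogonal_conj_cancel[OF U]
    by (simp add: X D_def)
  define e where "e i = D $ i $ i" for i
  have "D = diag_mat e"
    unfolding e_def using F_spectral D by (rule spectral_gradient_at_diag_mat_is_diagonal)
  moreover have "G = U ** D ** transpose U"
    using orthogonal_conj_cancel[OF U', of G] by (simp add: D_def)
  ultimately have G_eq: "G = U ** diag_mat e ** transpose U"
    by simp
  have deriv: "((\<lambda>x. real_of_ereal (\<phi> x)) has_real_derivative e i) (at (d i))" for i
    unfolding e_def
    using F_spectral phi_not_minf phi_finite d_pos D by (rule spectral_gradient_diagonal_entry)
  have e_eq: "e i = e j" if "d i = d j" for i j
    using deriv[of i] deriv[of j] unfolding that by (rule DERIV_unique)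
  have "\<exists>p. \<forall>i\<in>UNIV. poly p (d i) = e i"
    by (intro polynomial_interpolation e_eq) auto
  then obtain p where p: "\<And>i. poly p (d i) = e i"
    by blast
  have d_eq: "d i = d j" if "e i = e j" for i j
  proof (rule strictly_convex_derivative_inj)
    show "((\<lambda>x. real_of_ereal (\<phi> x)) has_real_derivative e j) (at (d i))"
      using deriv[of i] that by simp
    show "((\<lambda>x. real_of_ereal (\<phi> x)) has_real_derivative e j) (at (d j))"
      by (rule deriv)
    show "real_of_ereal (\<phi> ((1 - t) * x + t * y))
        < (1 - t) * real_of_ereal (\<phi> x) + t * real_of_ereal (\<phi> y)"
      if "0 < x" "0 < y" "x \<noteq> y" "0 < t" "t < 1" for x y t
      using F_class F_spectral phi_not_minf phi_finite that
      by (rule spectral_profile_strictly_convex)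
  qed (rule d_pos)+
  have "\<exists>q. \<forall>i\<in>UNIV. poly q (e i) = d i"
    by (intro polynomial_interpolation d_eq) auto
  then obtain q where q: "\<And>i. poly q (e i) = d i"
    by blast
  note closed = jordan_subspace_polynomial_closed[OF L_subspace L_id L_jordan U]
  have "X \<in> L \<longleftrightarrow> G \<in> L"
    using closed[of d p] closed[of e q] by (auto simp: p q X G_eq)
  moreover have "sym_gradient F X = G"
    using G X_sym by (rule sym_gradient_eqI)
  ultimately show ?thesis
    using X_pd by (auto simp: gradient_image_def)
qed

end
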